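(* Let $f:\mathbb{R}^n\to\mathbb{R}$ be a convex, twice continuously differentiable function with a minimizer $x^*$. Let $x_0\in\mathbb{R}^n$ be a starting point, $\mathcal{L}_0=\{x\in\mathbb{R}^n: f(x)\le f(x_0)\}$, and let $L>0$ be such that $\|\nabla^2 f(x)\|\le L$ for all $x\in\mathcal{L}_0$. Let $m,M>0$, put $\delta=\frac{2}{3}\frac{m}{M+2L}$, and suppose that $\nabla^2 f(x^* )\succeq mI$ and that $\|\nabla^2 f(x)-\nabla^2 f(y)\|\le M\|x-y\|$ for all $x,y\in\mathbb{B}(x^*,\delta)$. Let $m_0=m\left(\frac13 M+2L\right)(M+2L)^{-1}$ and $r_0=\min\{r:\mathcal{L}_0\subset\mathbb{B}(x^*,r)\}$. Let the accuracy parameter $\varepsilon$ satisfy $0<\varepsilon<\delta$ and $\varepsilon^{0.5}<m_0(L+\|\nabla f(x)\|)^{-0.5}$ for all $x\in\mathcal{L}_0$. Then the damped regularized Newton's method (DRNM) started at $x_0$ takes at most $$N_0=13.5\,\frac{L^2(M+2L)^3}{(m_0m)^3}\,(1+r_0)\,\bigl(f(x_0)-f(x^* )\bigr)$$ steps to get a point $x\in\mathbb{B}(x^*,\delta)$.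
   Context: $\|\cdot\|$ is the Euclidean norm (and the induced operator norm for matrices), $(\cdot,\cdot)$ is the Euclidean inner product, $I$ is the identity matrix, $A\succeq B$ means that $A-B$ is positive semidefinite, and $\mathbb{B}(x^*,r)=\{x\in\mathbb{R}^n:\|x-x^*\|\le r\}$. Let $H(x)=\nabla^2 f(x)+\|\nabla f(x)\|I$. The regularized Newton's direction $r(x)$ at $x$ is the solution of the linear system $H(x)r(x)=-\nabla f(x)$, and the regularized Newton's decrement is $\lambda_r(x)=\bigl(H^{-1}(x)\nabla f(x),\nabla f(x)\bigr)^{1/2}$. The damped regularized Newton's method (DRNM), with parameters $L,\varepsilon$ and starting point $x_0$: set $x:=x_0$ and then 1. compute $r(x)$ by solving $H(x)r(x)=-\nabla f(x)$; 2. if $f(x+r(x))\le f(x)+0.5(\nabla f(x),r(x))$, set $t(x):=1$; otherwise set $t(x):=(2L)^{-1}\|\nabla f(x)\|$; 3. set $x:=x+t(x)r(x)$; 4. if $\lambda_r(x)\le\varepsilon^{1.5}$, stop and output $x$ as the approximation of $x^*$; otherwise go to 1. One DRNM step is one pass through 1.–3. *)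

theory Defs
  imports "HOL-Analysis.Analysis"
begin

definition grad :: "(real ^ 'n \<Rightarrow> real) \<Rightarrow> real ^ 'n \<Rightarrow> real ^ 'n" where
  "grad f x = (THE g. gderiv f x g)"

definition hess :: "(real ^ 'n \<Rightarrow> real) \<Rightarrow> real ^ 'n \<Rightarrow> real ^ 'n ^ 'n" where
  "hess f x = jacobian (grad f) (at x)"

(* Continuity of f and of grad f follows from their differentiability. *)
definition twice_cont_diff :: "(real ^ 'n \<Rightarrow> real) \<Rightarrow> bool" where
  "twice_cont_diff f \<longleftrightarrow>
     (\<forall>x. f differentiable (at x)) \<and> (\<forall>x. grad f differentiable (at x)) \<and>
     continuous_on UNIV (hess f)"

definition op_norm :: "real ^ 'n ^ 'n \<Rightarrow> real" where
  "op_norm A = onorm ((*v) A)"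

definition pos_semidef :: "real ^ 'n ^ 'n \<Rightarrow> bool" where
  "pos_semidef A \<longleftrightarrow> transpose A = A \<and> (\<forall>v. 0 \<le> (A *v v) \<bullet> v)"

definition reg_hess :: "(real ^ 'n \<Rightarrow> real) \<Rightarrow> real ^ 'n \<Rightarrow> real ^ 'n ^ 'n" where
  "reg_hess f x = hess f x + norm (grad f x) *\<^sub>R mat 1"

definition newton_dir :: "(real ^ 'n \<Rightarrow> real) \<Rightarrow> real ^ 'n \<Rightarrow> real ^ 'n" where
  "newton_dir f x = (THE r. reg_hess f x *v r = - grad f x)"

definition newton_decrement :: "(real ^ 'n \<Rightarrow> real) \<Rightarrow> real ^ 'n \<Rightarrow> real" where
  "newton_decrement f x = sqrt ((matrix_inv (reg_hess f x) *v grad f x) \<bullet> grad f x)"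

definition step_size :: "(real ^ 'n \<Rightarrow> real) \<Rightarrow> real \<Rightarrow> real ^ 'n \<Rightarrow> real" where
  "step_size f L x =
     (if f (x + newton_dir f x) \<le> f x + 0.5 * (grad f x \<bullet> newton_dir f x)
      then 1 else inverse (2 * L) * norm (grad f x))"

definition drnm_step :: "(real ^ 'n \<Rightarrow> real) \<Rightarrow> real \<Rightarrow> real ^ 'n \<Rightarrow> real ^ 'n" where
  "drnm_step f L x = x + step_size f L x *\<^sub>R newton_dir f x"

(* drnm_at f L e x0 k x: the method started at x0 performs at least k steps, and x is its
   current point after exactly k steps. The stopping test is made on the updated point at
   the end of a step, so the starting point itself is never tested. *)
inductive drnm_at :: "(real ^ 'n \<Rightarrow> real) \<Rightarrow> real \<Rightarrow> real \<Rightarrow> real ^ 'n \<Rightarrow> nat \<Rightarrow> real ^ 'n \<Rightarrow> bool"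
  for f L \<epsilon> x0 where
  start: "drnm_at f L \<epsilon> x0 0 x0"
| step: "drnm_at f L \<epsilon> x0 k x \<Longrightarrow> k = 0 \<or> \<not> newton_decrement f x \<le> \<epsilon> powr 1.5 \<Longrightarrow>
           drnm_at f L \<epsilon> x0 (Suc k) (drnm_step f L x)"

end

theory Submission
  imports Defs
begin

text \<open>The proof is an energy argument: as long as the iterates stay outside the ball of radius \<open>\<delta>\<close> around
the minimizer, every step lowers \<open>f\<close> by a fixed amount \<open>D\<close>, and \<open>N\<^sub>0\<close> is exactly \<open>(f x0 - f xs) / D\<close>.

The constants \<open>\<delta>\<close> and \<open>m\<^sub>0\<close> are matched so that \<open>m\<^sub>0 = m - M \<delta>\<close>: by the Lipschitz condition the Hessian is
at least \<open>m\<^sub>0\<close> throughout the ball. Integrating along rays from the minimizer gives \<open>\<parallel>grad f x\<parallel> \<ge> m\<^sub>0 \<delta>\<close>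
outside the ball (\<open>grad_norm_outside_ball\<close>), and linear growth of \<open>f\<close> there (\<open>linear_growth\<close>), so the
sublevel set of the starting point is bounded.

The regularized Hessian \<open>R\<close> is symmetric and lies between \<open>\<gamma>\<close> and \<open>L + \<gamma>\<close>, where \<open>\<gamma> = \<parallel>grad f x\<parallel>\<close>. The
upper bound makes the squared decrement \<open>q = \<lambda>\<^sup>2\<close> at least \<open>\<gamma>\<^sup>2 / (L + \<gamma>)\<close>; the lower bound keeps the Newton
direction short, \<open>\<gamma> \<parallel>r\<parallel>\<^sup>2 \<le> q\<close>. So a full step, when accepted, gains at least \<open>q / 2\<close>, and a damped step
\<open>(3/8) (\<gamma> / L) q\<close> (\<open>drnm_step_decrease\<close>). With \<open>\<gamma> \<ge> m\<^sub>0 \<delta>\<close>, and \<open>\<gamma> \<le> L r\<^sub>0\<close> on the sublevel set, both gains are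
at least \<open>D = (m\<^sub>0 \<delta>)\<^sup>3 / (4 L\<^sup>2 (1 + r\<^sub>0))\<close>.

Finally, the method does not stop too early: a decrement of at most \<open>\<epsilon>\<close> to the power \<open>1.5\<close> forces
\<open>\<gamma> < m\<^sub>0 \<epsilon> < m\<^sub>0 \<delta>\<close> (\<open>stopping_test_grad_small\<close>), which is impossible outside the ball.\<close>

section \<open>Gradient and Hessian\<close>

lemma has_derivative_grad:
  fixes f :: "real ^ 'n \<Rightarrow> real"
  assumes "f differentiable (at x)"
  shows "(f has_derivative (\<lambda>h. grad f x \<bullet> h)) (at x)"
proof -
  obtain f' where f': "(f has_derivative f') (at x)"
    using assms by (auto simp: differentiable_def)
  interpret bounded_linear f'
    using f' by (rule has_derivative_bounded_linear)
  have rep: "f' h = h \<bullet> (\<Sum>b\<in>Basis. f' b *\<^sub>R b)" for h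
  proof -
    have "f' h = f' (\<Sum>b\<in>Basis. (h \<bullet> b) *\<^sub>R b)"
      by (simp add: euclidean_representation)
    also have "\<dots> = h \<bullet> (\<Sum>b\<in>Basis. f' b *\<^sub>R b)"
      by (simp add: sum scaleR inner_sum_right mult.commute)
    finally show ?thesis .
  qed
  have D: "gderiv f x (\<Sum>b\<in>Basis. f' b *\<^sub>R b)"
    unfolding gderiv_def using f' rep by (metis (no_types, lifting) ext)
  have unique: "g = g'" if "gderiv f x g" "gderiv f x g'" for g g'
  proof -
    have "(\<lambda>h. h \<bullet> g) = (\<lambda>h. h \<bullet> g')"
      using that unfolding gderiv_def by (rule has_derivative_unique)
    then have "h \<bullet> g = h \<bullet> g'" for h
      by metis
    then show ?thesis
      using vector_eq_ldot by blast
  qed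
  have "gderiv f x (grad f x)"
    unfolding grad_def by (rule theI[of _ "\<Sum>b\<in>Basis. f' b *\<^sub>R b"]) (use D unique in blast)+
  then show ?thesis
    by (simp add: gderiv_def inner_commute)
qed

lemma has_derivative_hess:
  fixes f :: "real ^ 'n \<Rightarrow> real"
  assumes "twice_cont_diff f"
  shows "(grad f has_derivative (\<lambda>h. hess f x *v h)) (at x)"
  using assms unfolding twice_cont_diff_def hess_def by (metis jacobian_works)

text \<open>All later arguments restrict \<open>f\<close> to a line \<open>s \<mapsto> x + s v\<close> and use one-variable calculus there; this
lemma and the next give the first two derivatives of such a restriction.\<close>
lemma line_deriv:
  fixes f :: "real ^ 'n \<Rightarrow> real"
  assumes "twice_cont_diff f"
  shows "((\<lambda>s. f (x + s *\<^sub>R v)) has_real_derivative grad f (x + s *\<^sub>R v) \<bullet> v) (at s)"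
proof -
  have f: "(f has_derivative (\<lambda>h. grad f y \<bullet> h)) (at y within S)" for y S
    using assms has_derivative_grad has_derivative_at_withinI unfolding twice_cont_diff_def by blast
  have "((\<lambda>s. f (x + s *\<^sub>R v)) has_derivative (\<lambda>h. grad f (x + s *\<^sub>R v) \<bullet> (h *\<^sub>R v))) (at s)"
    by (rule has_derivative_compose[OF _ f, of "\<lambda>s. x + s *\<^sub>R v"])
       (auto intro!: derivative_eq_intros)
  then show ?thesis
    by (simp add: has_field_derivative_def mult_commute_abs)
qed

lemma line_deriv2:
  fixes f :: "real ^ 'n \<Rightarrow> real"
  assumes "twice_cont_diff f"
  shows "((\<lambda>s. grad f (x + s *\<^sub>R v) \<bullet> w) has_real_derivative (hess f (x + s *\<^sub>R v) *v v) \<bullet> w) (at s)"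
proof -
  have "((\<lambda>s. grad f (x + s *\<^sub>R v)) has_derivative (\<lambda>h. hess f (x + s *\<^sub>R v) *v (h *\<^sub>R v))) (at s)"
    by (rule has_derivative_compose[OF _ has_derivative_at_withinI[OF has_derivative_hess[OF assms]],
          of "\<lambda>s. x + s *\<^sub>R v"])
       (auto intro!: derivative_eq_intros)
  from has_derivative_inner_left[OF this, of w] show ?thesis
    by (simp add: has_field_derivative_def mult_commute_abs matrix_vector_mult_scaleR)
qed

text \<open>The second difference of \<open>f\<close> is symmetric in the increments \<open>u\<close> and \<open>v\<close>, while its leading term is
the Hessian form. By the mean value theorem in the direction \<open>u\<close>, it equals the change of
\<open>grad f \<bullet> u\<close> under the shift by \<open>v\<close>, taken at an intermediate base point; differentiability of the
gradient at \<open>x\<close> alone turns this into \<open>(hess f x *v v) \<bullet> u\<close> with an error \<open>o((\<parallel>u\<parallel> + \<parallel>v\<parallel>)\<^sup>2)\<close>.\<close>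
lemma second_difference:
  fixes f :: "real ^ 'n \<Rightarrow> real"
  assumes f: "twice_cont_diff f" and "e > 0"
  obtains d where "d > 0"
    "\<And>u v. norm u + norm v < d \<Longrightarrow>
       \<bar>f (x + u + v) - f (x + u) - f (x + v) + f x - (hess f x *v v) \<bullet> u\<bar> \<le> e * (norm u + norm v)\<^sup>2"
proof -
  obtain d where d: "d > 0" and
    dd: "\<And>y. norm (y - x) < d \<Longrightarrow> norm (grad f y - grad f x - hess f x *v (y - x)) \<le> e/2 * norm (y - x)"
    using has_derivative_hess[OF f, of x] \<open>e > 0\<close> unfolding has_derivative_at_alt
    by (metis half_gt_zero)
  have "\<bar>f (x + u + v) - f (x + u) - f (x + v) + f x - (hess f x *v v) \<bullet> u\<bar> \<le> e * (norm u + norm v)\<^sup>2"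
    if uv: "norm u + norm v < d" for u v
  proof -
    let ?\<psi> = "\<lambda>s. f (x + v + s *\<^sub>R u) - f (x + s *\<^sub>R u)"
    have "\<exists>z::real. 0 < z \<and> z < 1 \<and> ?\<psi> 1 - ?\<psi> 0
        = (1 - 0) * (grad f (x + v + z *\<^sub>R u) \<bullet> u - grad f (x + z *\<^sub>R u) \<bullet> u)"
      by (rule MVT2) (auto intro!: derivative_eq_intros line_deriv[OF f])
    then obtain z where z: "0 < z" "z < 1"
      and eq: "?\<psi> 1 - ?\<psi> 0 = grad f (x + v + z *\<^sub>R u) \<bullet> u - grad f (x + z *\<^sub>R u) \<bullet> u"
      by auto
    \<comment> \<open>Linearisation errors of the gradient at two points that differ by \<open>v\<close>; in \<open>p - q\<close> the common terms
      cancel, leaving the increment of the gradient minus \<open>hess f x *v v\<close>.\<close>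
    define p where "p = grad f (x + v + z *\<^sub>R u) - grad f x - hess f x *v (v + z *\<^sub>R u)"
    define q where "q = grad f (x + z *\<^sub>R u) - grad f x - hess f x *v (z *\<^sub>R u)"
    have zu: "norm (z *\<^sub>R u) \<le> norm u"
      using z by (simp add: mult_left_le_one_le)
    then have vzu: "norm (v + z *\<^sub>R u) \<le> norm u + norm v"
      using norm_triangle_ineq[of v "z *\<^sub>R u"] by linarith
    have "norm p \<le> e/2 * norm (v + z *\<^sub>R u)"
      using dd[of "x + v + z *\<^sub>R u"] vzu uv unfolding p_def by (simp add: add.assoc)
    also have "\<dots> \<le> e/2 * (norm u + norm v)"
      using vzu \<open>e > 0\<close> by (intro mult_left_mono) auto
    finally have p: "norm p \<le> e/2 * (norm u + norm v)" .
    have "norm q \<le> e/2 * norm (z *\<^sub>R u)"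
      using dd[of "x + z *\<^sub>R u"] zu uv norm_ge_zero[of v] unfolding q_def
      by (simp del: norm_ge_zero norm_scaleR)
    also have "\<dots> \<le> e/2 * (norm u + norm v)"
      using zu \<open>e > 0\<close> norm_ge_zero[of v] by (intro mult_left_mono) linarith+
    finally have q: "norm q \<le> e/2 * (norm u + norm v)" .
    have "f (x + u + v) - f (x + u) - f (x + v) + f x - (hess f x *v v) \<bullet> u = (p - q) \<bullet> u"
      using eq unfolding p_def q_def
      by (simp add: matrix_vector_right_distrib inner_diff_left inner_add_left algebra_simps)
    also have "\<bar>\<dots>\<bar> \<le> norm (p - q) * norm u"
      by (rule Cauchy_Schwarz_ineq2)
    also have "\<dots> \<le> (e * (norm u + norm v)) * (norm u + norm v)"
      using p q norm_triangle_ineq4[of p q] \<open>e > 0\<close> by (intro mult_mono) (auto simp: algebra_simps)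
    finally show ?thesis
      by (simp add: power2_eq_square mult.assoc)
  qed
  with d that show ?thesis by blast
qed

text \<open>Exchanging \<open>u\<close> and \<open>v\<close> in the second difference changes only the Hessian term. Both sides scale
quadratically, so the error bound, valid for small increments only, holds for all of them.

Symmetry is what makes the regularized Newton decrement large: without it, a positive semidefinite
matrix of norm at most \<open>c\<close> need not satisfy \<open>\<parallel>R v\<parallel>\<^sup>2 \<le> c (R v, v)\<close>, as a rotation by a right angle shows.\<close>
lemma hess_symmetric:
  fixes f :: "real ^ 'n \<Rightarrow> real"
  assumes f: "twice_cont_diff f"
  shows "(hess f x *v u) \<bullet> v = (hess f x *v v) \<bullet> u"
proof -
  let ?D = "\<bar>(hess f x *v u) \<bullet> v - (hess f x *v v) \<bullet> u\<bar>"
  let ?n = "norm u + norm v"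
  have small: "?D \<le> 2 * e * ?n\<^sup>2" if e: "e > 0" for e
  proof -
    obtain d where "d > 0" and d: "\<And>u v. norm u + norm v < d \<Longrightarrow>
       \<bar>f (x + u + v) - f (x + u) - f (x + v) + f x - (hess f x *v v) \<bullet> u\<bar> \<le> e * (norm u + norm v)\<^sup>2"
      using second_difference[OF f e] by blast
    define t where "t = d / (2 * (1 + ?n))"
    have pos: "2 * (1 + ?n) > 0"
      by (simp add: add_pos_nonneg)
    have t: "t > 0"
      unfolding t_def using \<open>d > 0\<close> pos by (rule divide_pos_pos)
    have "t * ?n < t * (2 * (1 + ?n))"
      using t pos by (intro mult_strict_left_mono) auto
    also have "\<dots> = d"
      unfolding t_def using pos by simp
    finally have tn: "t * ?n < d" .
    have n: "norm (t *\<^sub>R u) + norm (t *\<^sub>R v) = t * ?n"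
      using t by (simp add: algebra_simps)
    have a: "\<bar>f (x + t *\<^sub>R u + t *\<^sub>R v) - f (x + t *\<^sub>R u) - f (x + t *\<^sub>R v) + f x - t\<^sup>2 * ((hess f x *v v) \<bullet> u)\<bar> \<le> e * (t * ?n)\<^sup>2"
      using d[of "t *\<^sub>R u" "t *\<^sub>R v"] n t tn by (simp add: matrix_vector_mult_scaleR power2_eq_square mult.assoc)
    have n': "norm (t *\<^sub>R v) + norm (t *\<^sub>R u) = t * ?n"
      using n by simp
    have "\<bar>f (x + t *\<^sub>R v + t *\<^sub>R u) - f (x + t *\<^sub>R v) - f (x + t *\<^sub>R u) + f x - t\<^sup>2 * ((hess f x *v u) \<bullet> v)\<bar> \<le> e * (t * ?n)\<^sup>2"
      using d[of "t *\<^sub>R v" "t *\<^sub>R u"] n' t tn by (simp add: matrix_vector_mult_scaleR power2_eq_square mult.assoc)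
    with a have "\<bar>t\<^sup>2 * ((hess f x *v u) \<bullet> v) - t\<^sup>2 * ((hess f x *v v) \<bullet> u)\<bar> \<le> 2 * (e * (t * ?n)\<^sup>2)"
      by (simp add: add.assoc add.commute[of "t *\<^sub>R u"])
    then have "t\<^sup>2 * ?D \<le> t\<^sup>2 * (2 * e * ?n\<^sup>2)"
      by (simp add: right_diff_distrib[symmetric] abs_mult power_mult_distrib mult.assoc mult.left_commute)
    then show ?thesis
      using t by (simp add: mult_le_cancel_left_pos)
  qed
  have "?D \<le> 0 + e" if "e > 0" for e
  proof -
    have "?D \<le> 2 * (e / (2 * (1 + ?n\<^sup>2))) * ?n\<^sup>2"
      using that by (intro small) (simp add: add_pos_nonneg)
    also have "\<dots> = e * (?n\<^sup>2 / (1 + ?n\<^sup>2))"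
      by (simp add: divide_simps)
    also have "\<dots> \<le> e * 1"
      using that by (intro mult_left_mono) (auto simp: divide_simps add_pos_nonneg)
    finally show ?thesis by simp
  qed
  then have "?D \<le> 0" by (rule field_le_epsilon)
  then show ?thesis by simp
qed

section \<open>Convexity along lines\<close>

lemma convex_line:
  fixes f :: "real ^ 'n \<Rightarrow> real"
  assumes "convex_on UNIV f"
  shows "convex_on UNIV (\<lambda>s. f (x + s *\<^sub>R v))"
proof (rule convex_onI)
  fix t s r :: real
  assume t: "0 < t" "t < 1"
  have "x + ((1 - t) *\<^sub>R s + t *\<^sub>R r) *\<^sub>R v = (1 - t) *\<^sub>R (x + s *\<^sub>R v) + t *\<^sub>R (x + r *\<^sub>R v)"
    by (simp add: algebra_simps)
  then show "f (x + ((1 - t) *\<^sub>R s + t *\<^sub>R r) *\<^sub>R v) \<le> (1 - t) * f (x + s *\<^sub>R v) + t * f (x + r *\<^sub>R v)"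
    using convex_onD[OF assms, of t "x + s *\<^sub>R v" "x + r *\<^sub>R v"] t by simp
qed simp

lemma convex_line_tangent:
  fixes f :: "real ^ 'n \<Rightarrow> real"
  assumes "convex_on UNIV f" "twice_cont_diff f"
  shows "f (x + r *\<^sub>R v) - f (x + s *\<^sub>R v) \<ge> (grad f (x + s *\<^sub>R v) \<bullet> v) * (r - s)"
  by (rule convex_on_imp_above_tangent[OF convex_line[OF assms(1)], of s r])
     (auto intro: line_deriv[OF assms(2)])

lemma convex_line_mono:
  fixes f :: "real ^ 'n \<Rightarrow> real"
  assumes "convex_on UNIV f" "twice_cont_diff f" "s \<le> r"
  shows "grad f (x + s *\<^sub>R v) \<bullet> v \<le> grad f (x + r *\<^sub>R v) \<bullet> v"
proof (cases "s = r")
  case False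
  with assms have "s < r" by simp
  have "(grad f (x + s *\<^sub>R v) \<bullet> v) * (r - s) \<le> (grad f (x + r *\<^sub>R v) \<bullet> v) * (r - s)"
    using convex_line_tangent[OF assms(1,2), of x s v r] convex_line_tangent[OF assms(1,2), of x r v s]
    by (simp add: algebra_simps)
  with \<open>s < r\<close> show ?thesis by simp
qed simp

lemma hess_psd:
  fixes f :: "real ^ 'n \<Rightarrow> real"
  assumes "convex_on UNIV f" "twice_cont_diff f"
  shows "(hess f x *v v) \<bullet> v \<ge> 0"
proof (rule ccontr)
  assume "\<not> ?thesis"
  then obtain d where "d > 0" and d: "\<And>h. 0 < h \<Longrightarrow> h < d \<Longrightarrow>
      grad f (x + 0 *\<^sub>R v) \<bullet> v > grad f (x + (0 + h) *\<^sub>R v) \<bullet> v"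
    using DERIV_neg_dec_right[OF line_deriv2[OF assms(2), of x v v 0]] by auto
  show False
    using d[of "d/2"] \<open>d > 0\<close> convex_line_mono[OF assms, of 0 "d/2" x v] by simp
qed

section \<open>The regularized Hessian and the Newton direction\<close>

lemma norm_matrix_vector_le_op_norm:
  fixes A :: "real ^ 'n ^ 'n"
  shows "norm (A *v v) \<le> op_norm A * norm v"
  unfolding op_norm_def by (rule onorm) simp

lemma quad_form_le_op_norm:
  fixes A :: "real ^ 'n ^ 'n"
  shows "\<bar>(A *v v) \<bullet> v\<bar> \<le> op_norm A * (norm v)\<^sup>2"
proof -
  have "\<bar>(A *v v) \<bullet> v\<bar> \<le> norm (A *v v) * norm v"
    by (rule Cauchy_Schwarz_ineq2)
  also have "\<dots> \<le> op_norm A * norm v * norm v"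
    by (intro mult_right_mono norm_matrix_vector_le_op_norm) simp
  finally show ?thesis by (simp add: power2_eq_square mult.assoc)
qed

text \<open>In terms of eigenvalues this is \<open>\<rho>\<^sup>2 \<le> c \<rho>\<close> for \<open>0 \<le> \<rho> \<le> c\<close>. Instead of diagonalising, the proof
evaluates the form of \<open>R\<close> at \<open>c v - R v\<close>, which is nonnegative.\<close>
lemma symmetric_psd_norm_bound:
  fixes R :: "real ^ 'n ^ 'n"
  assumes sym: "\<And>u v. (R *v u) \<bullet> v = (R *v v) \<bullet> u"
    and psd: "\<And>v. (R *v v) \<bullet> v \<ge> 0"
    and bd: "\<And>v. (R *v v) \<bullet> v \<le> c * (norm v)\<^sup>2" and "c > 0"
  shows "(norm (R *v v))\<^sup>2 \<le> c * ((R *v v) \<bullet> v)"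
proof -
  let ?w = "R *v v"
  let ?z = "c *\<^sub>R v - ?w"
  have "0 \<le> (R *v ?z) \<bullet> ?z" by (rule psd)
  also have "\<dots> = c\<^sup>2 * (?w \<bullet> v) - 2 * c * (norm ?w)\<^sup>2 + (R *v ?w) \<bullet> ?w"
    using sym[of ?w v]
    by (simp add: matrix_vector_mult_diff_distrib matrix_vector_mult_scaleR inner_diff_left
        inner_diff_right power2_norm_eq_inner power2_eq_square[of c] algebra_simps)
  also have "\<dots> \<le> c\<^sup>2 * (?w \<bullet> v) - 2 * c * (norm ?w)\<^sup>2 + c * (norm ?w)\<^sup>2"
    using bd[of ?w] by simp
  finally have "c * (norm ?w)\<^sup>2 \<le> c * (c * (?w \<bullet> v))"
    by (simp add: power2_eq_square algebra_simps)
  with \<open>c > 0\<close> show ?thesis by simp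
qed

lemma reg_hess_mult: "reg_hess f x *v v = hess f x *v v + norm (grad f x) *\<^sub>R v"
  by (simp add: reg_hess_def matrix_vector_mult_add_rdistrib scaleR_matrix_vector_assoc[symmetric])

lemma reg_hess_lower:
  fixes f :: "real ^ 'n \<Rightarrow> real"
  assumes "convex_on UNIV f" "twice_cont_diff f"
  shows "norm (grad f x) * (norm v)\<^sup>2 \<le> (reg_hess f x *v v) \<bullet> v"
  using hess_psd[OF assms, of x v] by (simp add: reg_hess_mult inner_add_left power2_norm_eq_inner)

lemma reg_hess_upper:
  fixes f :: "real ^ 'n \<Rightarrow> real"
  assumes cvx: "convex_on UNIV f" and C2: "twice_cont_diff f"
    and L: "op_norm (hess f x) \<le> L" "L > 0"
  shows "(norm (reg_hess f x *v v))\<^sup>2 \<le> (L + norm (grad f x)) * ((reg_hess f x *v v) \<bullet> v)"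
proof (rule symmetric_psd_norm_bound)
  show "(reg_hess f x *v u) \<bullet> w = (reg_hess f x *v w) \<bullet> u" for u w
    using hess_symmetric[OF C2, of x u w] by (simp add: reg_hess_mult inner_add_left inner_commute[of u w])
  show "(reg_hess f x *v w) \<bullet> w \<ge> 0" for w
    using reg_hess_lower[OF cvx C2, of x w] by (smt (verit) norm_ge_zero zero_le_power2 mult_nonneg_nonneg)
  show "(reg_hess f x *v w) \<bullet> w \<le> (L + norm (grad f x)) * (norm w)\<^sup>2" for w
    using quad_form_le_op_norm[of "hess f x" w] mult_right_mono[OF L(1), of "(norm w)\<^sup>2"]
    by (simp add: reg_hess_mult inner_add_left power2_norm_eq_inner algebra_simps)
  show "L + norm (grad f x) > 0"
    using L(2) by (simp add: add_pos_nonneg)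
qed

lemma reg_hess_invertible:
  fixes f :: "real ^ 'n \<Rightarrow> real"
  assumes "convex_on UNIV f" "twice_cont_diff f" "grad f x \<noteq> 0"
  shows "reg_hess f x *v v = w \<longleftrightarrow> v = matrix_inv (reg_hess f x) *v w"
proof -
  have "v = 0" if "reg_hess f x *v v = 0" for v
    using reg_hess_lower[OF assms(1,2), of x v] that assms(3) by (simp add: mult_le_0_iff)
  then have "invertible (reg_hess f x)"
    by (auto simp: invertible_left_inverse matrix_left_invertible_ker)
  then have "reg_hess f x ** matrix_inv (reg_hess f x) = mat 1 \<and>
      matrix_inv (reg_hess f x) ** reg_hess f x = mat 1"
    unfolding invertible_def matrix_inv_def by (rule someI_ex)
  then show ?thesis
    by (metis matrix_vector_mul_assoc matrix_vector_mul_lid)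
qed

lemma reg_hess_newton_dir:
  fixes f :: "real ^ 'n \<Rightarrow> real"
  assumes "convex_on UNIV f" "twice_cont_diff f" "grad f x \<noteq> 0"
  shows "reg_hess f x *v newton_dir f x = - grad f x"
  unfolding newton_dir_def
  by (rule theI'[where P = "\<lambda>r. reg_hess f x *v r = - grad f x"]) (simp add: reg_hess_invertible[OF assms])

lemma newton_decrement_eq:
  fixes f :: "real ^ 'n \<Rightarrow> real"
  assumes "convex_on UNIV f" "twice_cont_diff f" "grad f x \<noteq> 0"
  shows "newton_decrement f x = sqrt (- (grad f x \<bullet> newton_dir f x))"
proof -
  have "newton_dir f x = matrix_inv (reg_hess f x) *v (- grad f x)"
    using reg_hess_newton_dir[OF assms] by (simp add: reg_hess_invertible[OF assms])
  then have "matrix_inv (reg_hess f x) *v grad f x = - newton_dir f x"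
    using matrix_vector_mult_scaleR[of "matrix_inv (reg_hess f x)" "-1" "grad f x"] by simp
  then show ?thesis
    by (simp add: newton_decrement_def inner_commute)
qed

text \<open>The squared decrement \<open>- (grad f x \<bullet> r)\<close> controls the gradient. This follows from
\<open>reg_hess_upper\<close> applied to the Newton direction \<open>r\<close>, for which \<open>R r = - grad f x\<close>.\<close>
lemma grad_newton_dir_le:
  fixes f :: "real ^ 'n \<Rightarrow> real"
  assumes cvx: "convex_on UNIV f" and C2: "twice_cont_diff f"
    and L: "op_norm (hess f x) \<le> L" "L > 0" and g: "grad f x \<noteq> 0"
  shows "(norm (grad f x))\<^sup>2 / (L + norm (grad f x)) \<le> - (grad f x \<bullet> newton_dir f x)"
  using reg_hess_upper[OF cvx C2 L, of "newton_dir f x"] L(2)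
  by (simp add: reg_hess_newton_dir[OF cvx C2 g] divide_simps add_pos_nonneg mult.commute)

lemma grad_newton_dir_norm:
  fixes f :: "real ^ 'n \<Rightarrow> real"
  assumes "convex_on UNIV f" "twice_cont_diff f" "grad f x \<noteq> 0"
  shows "norm (grad f x) * (norm (newton_dir f x))\<^sup>2 \<le> - (grad f x \<bullet> newton_dir f x)"
  using reg_hess_lower[OF assms(1,2), of x "newton_dir f x"] by (simp add: reg_hess_newton_dir[OF assms])

section \<open>Decrease of the objective in one step\<close>

text \<open>The curvature bound is assumed only on the segment, because in the application the Hessian is
controlled only on a sublevel set.\<close>
lemma taylor_line_le:
  fixes f :: "real ^ 'n \<Rightarrow> real"
  assumes C2: "twice_cont_diff f" and s: "0 \<le> s"
    and L: "\<And>u. 0 \<le> u \<Longrightarrow> u \<le> s \<Longrightarrow> op_norm (hess f (x + u *\<^sub>R v)) \<le> L"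
  shows "f (x + s *\<^sub>R v) \<le> f x + s * (grad f x \<bullet> v) + s\<^sup>2 / 2 * L * (norm v)\<^sup>2"
proof (cases "s = 0")
  case False
  define diff :: "nat \<Rightarrow> real \<Rightarrow> real" where "diff m t =
    (if m = 0 then f (x + t *\<^sub>R v) else if m = 1 then grad f (x + t *\<^sub>R v) \<bullet> v
     else (hess f (x + t *\<^sub>R v) *v v) \<bullet> v)" for m t
  have "\<exists>t. 0 < t \<and> t < s \<and> f (x + s *\<^sub>R v)
      = (\<Sum>m<2. diff m 0 / fact m * (s - 0) ^ m) + diff 2 t / fact 2 * (s - 0)\<^sup>2"
  proof (rule Taylor_up[where a = 0])
    show "\<forall>m t. m < 2 \<and> 0 \<le> t \<and> t \<le> s \<longrightarrow> (diff m has_real_derivative diff (Suc m) t) (at t)"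
      using line_deriv[OF C2] line_deriv2[OF C2] by (auto simp: diff_def[abs_def] less_2_cases_iff)
  qed (use s False in \<open>auto simp: diff_def\<close>)
  then obtain t where t: "0 < t" "t < s" and eq: "f (x + s *\<^sub>R v)
      = f x + s * (grad f x \<bullet> v) + s\<^sup>2 / 2 * ((hess f (x + t *\<^sub>R v) *v v) \<bullet> v)"
    by (auto simp: diff_def numeral_2_eq_2 algebra_simps)
  have "(hess f (x + t *\<^sub>R v) *v v) \<bullet> v \<le> L * (norm v)\<^sup>2"
    using quad_form_le_op_norm[of "hess f (x + t *\<^sub>R v)" v]
      mult_right_mono[OF L[of t], of "(norm v)\<^sup>2"] t by simp
  from mult_left_mono[OF this, of "s\<^sup>2 / 2"] eq show ?thesis
    by simp
qed simp

text \<open>The quadratic upper model along a descent direction, when the Hessian is bounded only on the sublevel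
set of \<open>x\<close>. The smallness condition says that the model stays below \<open>f x\<close> up to \<open>t\<close>. Hence the path
cannot leave the sublevel set: at a return to the value \<open>f x\<close> the model would still apply, by convexity
of the sublevel set, and would give a value strictly below \<open>f x\<close>.\<close>
lemma descent_line:
  fixes f :: "real ^ 'n \<Rightarrow> real"
  assumes cvx: "convex_on UNIV f" and C2: "twice_cont_diff f"
    and L: "\<And>y. f y \<le> f x \<Longrightarrow> op_norm (hess f y) \<le> L"
    and t: "0 \<le> t" and desc: "grad f x \<bullet> v < 0"
    and small: "t * L * (norm v)\<^sup>2 < - 2 * (grad f x \<bullet> v)"
  shows "f (x + t *\<^sub>R v) \<le> f x + t * (grad f x \<bullet> v) + t\<^sup>2 / 2 * L * (norm v)\<^sup>2"
proof -
  have below: "f (x + u *\<^sub>R v) \<le> f x"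
    if s: "f (x + s *\<^sub>R v) \<le> f x" and u: "0 \<le> u" "u \<le> s" for s u
  proof (cases "s = 0")
    case False
    have "f (x + u *\<^sub>R v) = f ((1 - u / s) *\<^sub>R x + (u / s) *\<^sub>R (x + s *\<^sub>R v))"
      using False by (simp add: algebra_simps)
    also have "\<dots> \<le> (1 - u / s) * f x + u / s * f (x + s *\<^sub>R v)"
      by (rule convex_onD[OF cvx]) (use u False in auto)
    also have "\<dots> \<le> (1 - u / s) * f x + u / s * f x"
      using s u by (intro add_left_mono mult_left_mono) auto
    finally show ?thesis by (simp add: algebra_simps)
  qed (use u in simp)
  have step: "f (x + s *\<^sub>R v) \<le> f x + s * (grad f x \<bullet> v) + s\<^sup>2 / 2 * L * (norm v)\<^sup>2"
    if "f (x + s *\<^sub>R v) \<le> f x" "0 \<le> s" for s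
    using taylor_line_le[OF C2 that(2)] below[OF that(1)] L by blast
  have "f (x + t *\<^sub>R v) \<le> f x"
  proof (rule ccontr)
    assume "\<not> ?thesis"
    then have ft: "f (x + t *\<^sub>R v) > f x" by simp
    obtain d where "d > 0" and d: "\<And>h. 0 < h \<Longrightarrow> h < d \<Longrightarrow> f x > f (x + h *\<^sub>R v)"
      using DERIV_neg_dec_right[OF line_deriv[OF C2, of x v 0]] desc by auto
    have "t > 0" using ft t by (cases "t = 0") auto
    define h where "h = min (d / 2) t"
    have h: "0 < h" "h < d" "h \<le> t" using \<open>d > 0\<close> \<open>t > 0\<close> by (auto simp: h_def)
    have cont: "continuous_on {h..t} (\<lambda>s. f (x + s *\<^sub>R v))"
      using line_deriv[OF C2] by (intro continuous_at_imp_continuous_on) (blast intro: DERIV_isCont)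
    \<comment> \<open>\<open>h\<close> is a point where \<open>f\<close> has already dropped, which keeps the crossing point away from \<open>0\<close>.\<close>
    obtain s where s: "h \<le> s" "s \<le> t" "f (x + s *\<^sub>R v) = f x"
      using IVT'[of "\<lambda>s. f (x + s *\<^sub>R v)" h "f x" t] d[OF h(1,2)] ft h(3) cont by auto
    have "s > 0" using s h by simp
    have "0 \<le> s * (grad f x \<bullet> v) + s\<^sup>2 / 2 * L * (norm v)\<^sup>2"
      using step[of s] s \<open>s > 0\<close> by simp
    also have "\<dots> = s * (grad f x \<bullet> v + s * (L * (norm v)\<^sup>2) / 2)"
      by (simp add: power2_eq_square algebra_simps)
    finally have "- 2 * (grad f x \<bullet> v) \<le> s * (L * (norm v)\<^sup>2)"
      using \<open>s > 0\<close> by (simp add: zero_le_mult_iff)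
    moreover have "s * (L * (norm v)\<^sup>2) \<le> t * (L * (norm v)\<^sup>2)"
    proof (rule mult_right_mono)
      have "0 \<le> op_norm (hess f x)"
        unfolding op_norm_def by (rule onorm_pos_le) simp
      then show "0 \<le> L * (norm v)\<^sup>2" using L[of x] by simp
    qed (use s in simp)
    ultimately show False using small by (simp add: mult.assoc)
  qed
  then show ?thesis using step t by blast
qed

text \<open>Let \<open>\<gamma> = \<parallel>grad f x\<parallel>\<close> and let \<open>q\<close> be the squared decrement. A full step gains at least \<open>q / 2\<close> by
its acceptance test. For the damped step \<open>t = \<gamma> / (2 L)\<close>, the regularization gives \<open>\<gamma> \<parallel>r\<parallel>\<^sup>2 \<le> q\<close>, so the
second-order term \<open>t\<^sup>2 L \<parallel>r\<parallel>\<^sup>2 / 2\<close> is at most \<open>t q / 4\<close> and the gain is at least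
\<open>(3/4) t q = (3/8) (\<gamma> / L) q\<close>.\<close>
lemma drnm_step_decrease:
  fixes f :: "real ^ 'n \<Rightarrow> real"
  assumes cvx: "convex_on UNIV f" and C2: "twice_cont_diff f"
    and L: "\<And>y. f y \<le> f x \<Longrightarrow> op_norm (hess f y) \<le> L" "L > 0"
    and g: "grad f x \<noteq> 0"
  shows "f (drnm_step f L x) \<le> f x -
     min (1 / 2) (3 / 8 * norm (grad f x) / L) * ((norm (grad f x))\<^sup>2 / (L + norm (grad f x)))"
proof -
  let ?r = "newton_dir f x" and ?\<gamma> = "norm (grad f x)"
  define q where "q = - (grad f x \<bullet> ?r)"
  let ?c = "min (1 / 2) (3 / 8 * ?\<gamma> / L)"
  have \<gamma>: "?\<gamma> > 0" using g by simp
  have lower: "?\<gamma>\<^sup>2 / (L + ?\<gamma>) \<le> q"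
    unfolding q_def by (rule grad_newton_dir_le[OF cvx C2 L(1)[OF order_refl] L(2) g])
  moreover have "0 < ?\<gamma>\<^sup>2 / (L + ?\<gamma>)"
    using \<gamma> L(2) by (intro divide_pos_pos add_pos_nonneg) auto
  ultimately have q: "q > 0" by linarith
  have norm_r: "?\<gamma> * (norm ?r)\<^sup>2 \<le> q"
    unfolding q_def by (rule grad_newton_dir_norm[OF cvx C2 g])
  have "f (drnm_step f L x) \<le> f x - ?c * q"
  proof (cases "f (x + ?r) \<le> f x + 0.5 * (grad f x \<bullet> ?r)")
    case True
    have "f (drnm_step f L x) \<le> f x - 1/2 * q"
      using True by (simp add: drnm_step_def step_size_def q_def)
    moreover have "?c * q \<le> 1/2 * q" using q by (intro mult_right_mono) auto
    ultimately show ?thesis by linarith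
  next
    case False
    define t where "t = inverse (2 * L) * ?\<gamma>"
    have t: "t \<ge> 0" unfolding t_def using L(2) by simp
    have tL: "t * L * (norm ?r)\<^sup>2 \<le> q / 2"
      using norm_r L(2) unfolding t_def by (simp add: field_simps)
    have "f (drnm_step f L x) = f (x + t *\<^sub>R ?r)"
      using False by (simp add: drnm_step_def step_size_def t_def)
    also have "\<dots> \<le> f x + t * (grad f x \<bullet> ?r) + t\<^sup>2 / 2 * L * (norm ?r)\<^sup>2"
      by (rule descent_line[OF cvx C2 L(1)]) (use t tL q in \<open>auto simp: q_def\<close>)
    also have "\<dots> = f x - t * q + t / 2 * (t * L * (norm ?r)\<^sup>2)"
      by (simp add: q_def power2_eq_square)
    also have "\<dots> \<le> f x - t * q + t / 2 * (q / 2)"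
      using tL t by (intro add_left_mono mult_left_mono) auto
    also have "\<dots> = f x - (3 / 8 * ?\<gamma> / L) * q"
      using L(2) by (simp add: t_def field_simps)
    also have "\<dots> \<le> f x - ?c * q"
      using q by (intro diff_left_mono mult_right_mono) auto
    finally show ?thesis .
  qed
  also have "\<dots> \<le> f x - ?c * (?\<gamma>\<^sup>2 / (L + ?\<gamma>))"
    using lower \<gamma> L(2) by (intro diff_left_mono mult_left_mono) auto
  finally show ?thesis .
qed

section \<open>The gradient near and away from the minimizer\<close>

lemma grad_minimizer_eq_0:
  fixes f :: "real ^ 'n \<Rightarrow> real"
  assumes C2: "twice_cont_diff f" and min: "\<And>x. f xs \<le> f x"
  shows "grad f xs = 0"
proof -
  have "grad f (xs + 0 *\<^sub>R grad f xs) \<bullet> grad f xs = 0"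
    using line_deriv[OF C2, of xs "grad f xs" 0] by (rule DERIV_local_min[where d = 1]) (use min in auto)
  then show ?thesis by simp
qed

text \<open>Strong convexity inside a ball forces the radial derivative up to \<open>\<mu> \<delta>\<close> at its boundary, and
convexity keeps it there all the way outwards.\<close>
lemma radial_grad_lower:
  fixes f :: "real ^ 'n \<Rightarrow> real"
  assumes cvx: "convex_on UNIV f" and C2: "twice_cont_diff f" and g0: "grad f xs = 0"
    and \<delta>: "\<delta> > 0" "\<delta> \<le> s"
    and sc: "\<And>x v. x \<in> cball xs \<delta> \<Longrightarrow> \<mu> * (norm v)\<^sup>2 \<le> (hess f x *v v) \<bullet> v"
    and u: "norm u = 1"
  shows "\<mu> * \<delta> \<le> grad f (xs + s *\<^sub>R u) \<bullet> u"
proof -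
  obtain z where z: "0 < z" "z < \<delta>"
    "grad f (xs + \<delta> *\<^sub>R u) \<bullet> u - grad f (xs + 0 *\<^sub>R u) \<bullet> u = (\<delta> - 0) * ((hess f (xs + z *\<^sub>R u) *v u) \<bullet> u)"
    using MVT2[OF \<delta>(1), of "\<lambda>s. grad f (xs + s *\<^sub>R u) \<bullet> u" "\<lambda>s. (hess f (xs + s *\<^sub>R u) *v u) \<bullet> u"]
      line_deriv2[OF C2] by blast
  have "\<mu> \<le> (hess f (xs + z *\<^sub>R u) *v u) \<bullet> u"
    using sc[of "xs + z *\<^sub>R u" u] z u by (simp add: dist_norm)
  then have "\<mu> * \<delta> \<le> grad f (xs + \<delta> *\<^sub>R u) \<bullet> u"
    using z(3) \<delta>(1) g0 by (simp add: mult.commute)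
  also have "\<dots> \<le> grad f (xs + s *\<^sub>R u) \<bullet> u"
    by (rule convex_line_mono[OF cvx C2 \<delta>(2)])
  finally show ?thesis .
qed

lemma grad_norm_outside_ball:
  fixes f :: "real ^ 'n \<Rightarrow> real"
  assumes cvx: "convex_on UNIV f" and C2: "twice_cont_diff f" and g0: "grad f xs = 0"
    and \<delta>: "\<delta> > 0"
    and sc: "\<And>x v. x \<in> cball xs \<delta> \<Longrightarrow> \<mu> * (norm v)\<^sup>2 \<le> (hess f x *v v) \<bullet> v"
    and x: "x \<notin> cball xs \<delta>"
  shows "\<mu> * \<delta> \<le> norm (grad f x)"
proof -
  let ?u = "sgn (x - xs)"
  have ne: "x \<noteq> xs" "\<delta> \<le> norm (x - xs)"
    using x \<delta> by (auto simp: dist_norm norm_minus_commute)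
  have xeq: "xs + norm (x - xs) *\<^sub>R ?u = x"
    using ne by (simp add: sgn_div_norm)
  have "\<mu> * \<delta> \<le> grad f x \<bullet> ?u"
    using radial_grad_lower[OF cvx C2 g0 \<delta> ne(2) sc, of ?u] ne xeq by (simp add: norm_sgn)
  also have "\<dots> \<le> norm (grad f x) * norm ?u"
    by (rule norm_cauchy_schwarz)
  finally show ?thesis using ne by (simp add: norm_sgn)
qed

text \<open>This makes the sublevel sets bounded, so that they have a least enclosing radius around \<open>xs\<close>.\<close>
lemma linear_growth:
  fixes f :: "real ^ 'n \<Rightarrow> real"
  assumes cvx: "convex_on UNIV f" and C2: "twice_cont_diff f" and min: "\<And>x. f xs \<le> f x"
    and \<delta>: "\<delta> > 0" and \<mu>: "\<mu> \<ge> 0"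
    and sc: "\<And>x v. x \<in> cball xs \<delta> \<Longrightarrow> \<mu> * (norm v)\<^sup>2 \<le> (hess f x *v v) \<bullet> v"
  shows "\<mu> * \<delta> * (norm (x - xs) - \<delta>) \<le> f x - f xs"
proof (cases "norm (x - xs) \<le> \<delta>")
  case True
  then have "\<mu> * \<delta> * (norm (x - xs) - \<delta>) \<le> 0"
    using \<delta> \<mu> by (simp add: mult_le_0_iff)
  with min[of x] show ?thesis by linarith
next
  case False
  let ?u = "sgn (x - xs)"
  have ne: "x \<noteq> xs" using False \<delta> by auto
  then have xeq: "xs + norm (x - xs) *\<^sub>R ?u = x" and u: "norm ?u = 1"
    by (simp_all add: sgn_div_norm norm_sgn)
  have "\<mu> * \<delta> * (norm (x - xs) - \<delta>) \<le> (grad f (xs + \<delta> *\<^sub>R ?u) \<bullet> ?u) * (norm (x - xs) - \<delta>)"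
    using radial_grad_lower[OF cvx C2 grad_minimizer_eq_0[OF C2 min] \<delta> order_refl sc u] False
    by (intro mult_right_mono) auto
  also have "\<dots> \<le> f (xs + norm (x - xs) *\<^sub>R ?u) - f (xs + \<delta> *\<^sub>R ?u)"
    by (rule convex_line_tangent[OF cvx C2])
  also have "\<dots> \<le> f x - f xs"
    using min[of "xs + \<delta> *\<^sub>R ?u"] xeq by simp
  finally show ?thesis .
qed

text \<open>A least element picked by \<open>LEAST\<close> on the reals need not exist; here the supremum of the distances to
\<open>c\<close> is one, since closed balls attain their radius.\<close>
lemma least_enclosing_radius:
  fixes S :: "'a :: metric_space set"
  assumes "bounded S" "S \<noteq> {}"
  shows "S \<subseteq> cball c (LEAST r. S \<subseteq> cball c r)"
proof -
  let ?R = "SUP x\<in>S. dist c x"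
  have bdd: "bdd_above (dist c ` S)"
    using assms(1) unfolding bounded_any_center[of S c] bdd_above_def by auto
  have "S \<subseteq> cball c ?R"
    using bdd by (auto intro: cSUP_upper)
  moreover have "?R \<le> r" if "S \<subseteq> cball c r" for r
    using that assms(2) by (intro cSUP_least) auto
  ultimately have "(LEAST r. S \<subseteq> cball c r) = ?R"
    by (rule Least_equality)
  with \<open>S \<subseteq> cball c ?R\<close> show ?thesis by simp
qed

lemma grad_norm_le:
  fixes f :: "real ^ 'n \<Rightarrow> real"
  assumes C2: "twice_cont_diff f" and g0: "grad f xs = 0" and S: "convex S" "x \<in> S" "xs \<in> S"
    and L: "\<And>y. y \<in> S \<Longrightarrow> op_norm (hess f y) \<le> L"
  shows "norm (grad f x) \<le> L * norm (x - xs)"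
proof -
  have "norm (grad f x - grad f xs) \<le> L * norm (x - xs)"
    by (rule differentiable_bound[OF S(1) _ _ S(2,3), of _ "\<lambda>y. (*v) (hess f y)"])
       (use has_derivative_at_withinI[OF has_derivative_hess[OF C2]] L in \<open>auto simp: op_norm_def\<close>)
  then show ?thesis by (simp add: g0)
qed

section \<open>Stopping test and number of steps\<close>

text \<open>Squaring the two inequalities gives \<open>\<gamma>\<^sup>2 / (L + \<gamma>) \<le> \<lambda>\<^sup>2 \<le> \<epsilon>\<^sup>3\<close> and \<open>\<epsilon> (L + \<gamma>) < \<mu>\<^sup>2\<close>, where \<open>\<gamma>\<close> is the
norm of the gradient and \<open>\<lambda>\<close> the decrement; hence \<open>\<gamma>\<^sup>2 < \<epsilon>\<^sup>2 \<mu>\<^sup>2\<close>. In the application this means that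
the stopping test can succeed only inside the ball around the minimizer.\<close>
lemma stopping_test_grad_small:
  fixes f :: "real ^ 'n \<Rightarrow> real"
  assumes cvx: "convex_on UNIV f" and C2: "twice_cont_diff f"
    and L: "op_norm (hess f x) \<le> L" "L > 0" and "\<epsilon> > 0" "\<mu> > 0"
    and acc: "\<epsilon> powr 0.5 < \<mu> * (L + norm (grad f x)) powr (- 0.5)"
    and stop: "newton_decrement f x \<le> \<epsilon> powr 1.5"
  shows "norm (grad f x) < \<mu> * \<epsilon>"
proof (cases "grad f x = 0")
  case False
  let ?\<gamma> = "norm (grad f x)"
  let ?q = "- (grad f x \<bullet> newton_dir f x)"
  have c: "L + ?\<gamma> > 0" using L(2) by (simp add: add_pos_nonneg)
  have lower: "?\<gamma>\<^sup>2 / (L + ?\<gamma>) \<le> ?q"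
    by (rule grad_newton_dir_le[OF cvx C2 L False])
  moreover have "0 \<le> ?\<gamma>\<^sup>2 / (L + ?\<gamma>)"
    using c by simp
  ultimately have q0: "?q \<ge> 0" by (rule order_trans[rotated])
  have "sqrt ?q \<le> \<epsilon> powr 1.5"
    using stop unfolding newton_decrement_eq[OF cvx C2 False] .
  then have "(sqrt ?q)\<^sup>2 \<le> (\<epsilon> powr 1.5)\<^sup>2"
    by (rule power_mono) (use q0 in simp)
  moreover have "(\<epsilon> powr 1.5)\<^sup>2 = \<epsilon> ^ 3"
    unfolding power2_eq_square powr_add[symmetric] using \<open>\<epsilon> > 0\<close> by simp
  ultimately have q: "?q \<le> \<epsilon> ^ 3"
    unfolding real_sqrt_pow2[OF q0] by simp
  have "(\<epsilon> powr 0.5)\<^sup>2 < (\<mu> * (L + ?\<gamma>) powr (- 0.5))\<^sup>2"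
    by (rule power_strict_mono[OF acc]) auto
  moreover have "(\<epsilon> powr 0.5)\<^sup>2 = \<epsilon>"
    unfolding power2_eq_square powr_add[symmetric] using \<open>\<epsilon> > 0\<close> by simp
  moreover have "((L + ?\<gamma>) powr (- 0.5))\<^sup>2 = inverse (L + ?\<gamma>)"
    unfolding power2_eq_square powr_add[symmetric] using c by (simp add: powr_minus)
  ultimately have "\<epsilon> < \<mu>\<^sup>2 / (L + ?\<gamma>)"
    unfolding power_mult_distrib divide_inverse by metis
  then have \<epsilon>: "\<epsilon> * (L + ?\<gamma>) < \<mu>\<^sup>2"
    using c by (simp add: field_simps)
  have "?\<gamma>\<^sup>2 \<le> ?q * (L + ?\<gamma>)" using lower c by (simp add: field_simps)
  also have "\<dots> \<le> \<epsilon> ^ 3 * (L + ?\<gamma>)" using q c by (intro mult_right_mono) auto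
  also have "\<dots> = \<epsilon>\<^sup>2 * (\<epsilon> * (L + ?\<gamma>))" by (simp add: power3_eq_cube power2_eq_square)
  also have "\<dots> < \<epsilon>\<^sup>2 * \<mu>\<^sup>2" using \<epsilon> \<open>\<epsilon> > 0\<close> by (intro mult_strict_left_mono) auto
  also have "\<dots> = (\<mu> * \<epsilon>)\<^sup>2" by (simp add: power_mult_distrib)
  finally show ?thesis
    by (rule power2_less_imp_less) (use \<open>\<epsilon> > 0\<close> \<open>\<mu> > 0\<close> in simp)
qed (use assms in simp)

text \<open>The counting argument: outside \<open>B\<close> the method goes on and each step gains \<open>D\<close>, which is possible at
most \<open>(f x0 - f xs) / D\<close> times. The index sought is the first one at which the iteration, continued
regardless of the stopping test, is in \<open>B\<close>; up to there the test has not fired.\<close>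
lemma drnm_reaches:
  fixes f :: "real ^ 'n \<Rightarrow> real"
  assumes D: "D > 0" and min: "\<And>x. f xs \<le> f x"
    and step: "\<And>x. f x \<le> f x0 \<Longrightarrow> x \<notin> B \<Longrightarrow> f (drnm_step f L x) \<le> f x - D"
    and go: "\<And>x. f x \<le> f x0 \<Longrightarrow> x \<notin> B \<Longrightarrow> \<not> newton_decrement f x \<le> \<epsilon> powr 1.5"
  shows "\<exists>k x. drnm_at f L \<epsilon> x0 k x \<and> real k \<le> (f x0 - f xs) / D \<and> x \<in> B"
proof -
  define X where "X k = (drnm_step f L ^^ k) x0" for k
  have inv: "drnm_at f L \<epsilon> x0 k (X k) \<and> f (X k) \<le> f x0 - real k * D" if "\<And>j. j < k \<Longrightarrow> X j \<notin> B" for k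
    using that
  proof (induction k)
    case 0
    show ?case by (simp add: X_def drnm_at.start)
  next
    case (Suc k)
    then have IH: "drnm_at f L \<epsilon> x0 k (X k)" "f (X k) \<le> f x0 - real k * D" and k: "X k \<notin> B"
      by auto
    have "f (X k) \<le> f x0"
      using IH(2) D by (smt (verit) mult_nonneg_nonneg of_nat_0_le_iff)
    with k step[of "X k"] go[of "X k"] IH drnm_at.step[OF IH(1)] show ?case
      by (simp add: X_def algebra_simps)
  qed
  have bound: "real k \<le> (f x0 - f xs) / D" if "\<And>j. j < k \<Longrightarrow> X j \<notin> B" for k
  proof -
    have "f (X k) \<le> f x0 - real k * D" using inv[of k] that by blast
    with min[of "X k"] show ?thesis using D by (simp add: pos_le_divide_eq)
  qed
  have "\<exists>k. X k \<in> B"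
  proof (rule ccontr)
    assume "\<not> ?thesis"
    then have "real k \<le> (f x0 - f xs) / D" for k using bound by blast
    then show False using reals_Archimedean2[of "(f x0 - f xs) / D"] by (meson not_le)
  qed
  then have "X (LEAST k. X k \<in> B) \<in> B" by (rule LeastI_ex)
  moreover have "X j \<notin> B" if "j < (LEAST k. X k \<in> B)" for j
    using that by (rule not_less_Least)
  ultimately show ?thesis using inv bound by blast
qed

theorem theorem9p1:
  fixes f :: "real ^ 'n \<Rightarrow> real" and xs x0 :: "real ^ 'n"
    and \<L>\<^sub>0 :: "(real ^ 'n) set"
    and L m M \<delta> m\<^sub>0 r\<^sub>0 \<epsilon> N\<^sub>0 :: real
  assumes "convex_on UNIV f" and "twice_cont_diff f"
    and "\<forall>x. f xs \<le> f x"
    and "\<L>\<^sub>0 = {x. f x \<le> f x0}"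
    and "L > 0" and "\<forall>x\<in>\<L>\<^sub>0. op_norm (hess f x) \<le> L"
    and "m > 0" and "M > 0"
    and "\<delta> = 2 / 3 * (m / (M + 2 * L))"
    and "pos_semidef (hess f xs - m *\<^sub>R mat 1)"
    and "\<forall>x\<in>cball xs \<delta>. \<forall>y\<in>cball xs \<delta>. op_norm (hess f x - hess f y) \<le> M * norm (x - y)"
    and "m\<^sub>0 = m * (1 / 3 * M + 2 * L) * inverse (M + 2 * L)"
    and "r\<^sub>0 = (LEAST r. \<L>\<^sub>0 \<subseteq> cball xs r)"
    and "0 < \<epsilon>" and "\<epsilon> < \<delta>"
    and "\<forall>x\<in>\<L>\<^sub>0. \<epsilon> powr 0.5 < m\<^sub>0 * (L + norm (grad f x)) powr (- 0.5)"
    and "N\<^sub>0 = 13.5 * (L ^ 2 * (M + 2 * L) ^ 3 / (m\<^sub>0 * m) ^ 3) * (1 + r\<^sub>0) * (f x0 - f xs)"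
  shows "\<exists>k x. drnm_at f L \<epsilon> x0 k x \<and> real k \<le> N\<^sub>0 \<and> x \<in> cball xs \<delta>"
proof -
  note cvx = assms(1) and C2 = assms(2) and L = \<open>L > 0\<close> and m = \<open>m > 0\<close> and M = \<open>M > 0\<close>
  have min: "f xs \<le> f x" for x using assms(3) by blast
  have opL: "op_norm (hess f x) \<le> L" if "f x \<le> f x0" for x
    using assms(4,6) that by blast
  have g0: "grad f xs = 0" by (rule grad_minimizer_eq_0[OF C2 min])
  have denom: "M + 2 * L > 0" using L M by simp
  have \<delta>: "\<delta> > 0" using assms(9) m denom by simp
  have m0: "m\<^sub>0 > 0" using assms(12) m M L by simp
  have m0_eq: "m\<^sub>0 = m - M * \<delta>" unfolding assms(9,12) using denom by (simp add: divide_simps) (simp add: algebra_simps)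
  have hess_xs: "m * (norm v)\<^sup>2 \<le> (hess f xs *v v) \<bullet> v" for v
    using assms(10) unfolding pos_semidef_def
    by (simp add: matrix_vector_mult_diff_rdistrib inner_diff_left power2_norm_eq_inner
        scaleR_matrix_vector_assoc[symmetric])
  have sc: "m\<^sub>0 * (norm v)\<^sup>2 \<le> (hess f x *v v) \<bullet> v" if x: "x \<in> cball xs \<delta>" for x v
  proof -
    have "op_norm (hess f x - hess f xs) \<le> M * norm (x - xs)"
      using assms(11) x \<delta> by simp
    also have "\<dots> \<le> M * \<delta>"
      using x M by (simp add: dist_norm norm_minus_commute)
    finally have "op_norm (hess f x - hess f xs) * (norm v)\<^sup>2 \<le> M * \<delta> * (norm v)\<^sup>2"
      by (intro mult_right_mono) auto
    with quad_form_le_op_norm[of "hess f x - hess f xs" v] hess_xs[of v] show ?thesis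
      by (simp add: m0_eq matrix_vector_mult_diff_rdistrib inner_diff_left left_diff_distrib)
  qed
  have mL: "m \<le> L"
  proof -
    obtain v :: "real ^ 'n" where "norm v = 1" using vector_choose_size[of 1] by auto
    with hess_xs[of v] quad_form_le_op_norm[of "hess f xs" v] opL[OF min] show ?thesis by simp
  qed

  \<comment> \<open>Linear growth bounds the sublevel set, so the least enclosing radius exists.\<close>
  have sub: "\<L>\<^sub>0 \<subseteq> cball xs r\<^sub>0"
    unfolding assms(13)
  proof (rule least_enclosing_radius)
    have "norm (x - xs) \<le> \<delta> + (f x0 - f xs) / (m\<^sub>0 * \<delta>)" if "x \<in> \<L>\<^sub>0" for x
    proof -
      have "m\<^sub>0 * \<delta> * (norm (x - xs) - \<delta>) \<le> f x0 - f xs"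
        using linear_growth[OF cvx C2 min \<delta> _ sc, of x] m0 that assms(4) by simp
      then have "norm (x - xs) - \<delta> \<le> (f x0 - f xs) / (m\<^sub>0 * \<delta>)"
        using m0 \<delta> by (simp add: pos_le_divide_eq mult.commute)
      then show ?thesis by linarith
    qed
    then have "\<L>\<^sub>0 \<subseteq> cball xs (\<delta> + (f x0 - f xs) / (m\<^sub>0 * \<delta>))"
      by (auto simp: dist_norm norm_minus_commute)
    then show "bounded \<L>\<^sub>0" by (rule bounded_subset[OF bounded_cball])
    show "\<L>\<^sub>0 \<noteq> {}" using assms(4) by auto
  qed
  have xs_in: "xs \<in> \<L>\<^sub>0" using assms(4) min by simp
  then have r0: "r\<^sub>0 \<ge> 0" using sub by force
  have cvx0: "convex \<L>\<^sub>0"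
    unfolding convex_alt
  proof (intro ballI allI impI)
    fix x y and u :: real
    assume xy: "x \<in> \<L>\<^sub>0" "y \<in> \<L>\<^sub>0" and u: "0 \<le> u \<and> u \<le> 1"
    have "f ((1 - u) *\<^sub>R x + u *\<^sub>R y) \<le> (1 - u) * f x + u * f y"
      using u by (intro convex_onD[OF cvx]) auto
    also have "\<dots> \<le> f x0"
      using xy u assms(4) by (intro convex_bound_le) auto
    finally show "(1 - u) *\<^sub>R x + u *\<^sub>R y \<in> \<L>\<^sub>0" using assms(4) by simp
  qed

  \<comment> \<open>\<open>a\<close> is the lower bound for the gradient norm outside the ball, and \<open>D\<close> the guaranteed gain of a step;
    since \<open>\<delta>\<^sup>3 = (8/27) (m / (M + 2 L))\<^sup>3\<close> and \<open>4 \<cdot> 27/8 = 13.5\<close>, the bound \<open>N\<^sub>0\<close> is the total gap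
    divided by \<open>D\<close>.\<close>
  define a where "a = m\<^sub>0 * \<delta>"
  have a: "a > 0" unfolding a_def using m0 \<delta> by simp
  have aL: "a \<le> L"
  proof -
    have "\<delta> \<le> 1" unfolding assms(9) using mL M L denom by (simp add: divide_simps)
    moreover have "m\<^sub>0 \<le> m" using m0_eq M \<delta> by simp
    ultimately show ?thesis unfolding a_def using m0 mL \<delta> mult_mono[of m\<^sub>0 L \<delta> 1] by simp
  qed
  define D where "D = a ^ 3 / (4 * L\<^sup>2 * (1 + r\<^sub>0))"
  have D: "D > 0" unfolding D_def using a L r0 by simp
  have N0: "N\<^sub>0 = (f x0 - f xs) / D"
  proof -
    have c: "(m\<^sub>0 * m) ^ 3 \<noteq> 0" "M + 2 * L \<noteq> 0" "L \<noteq> 0" "1 + r\<^sub>0 \<noteq> 0"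
      using m0 m L denom r0 by auto
    have "a ^ 3 = (2 / 3) ^ 3 * ((m\<^sub>0 * m) ^ 3 / (M + 2 * L) ^ 3)"
      unfolding a_def assms(9) power_mult_distrib power_divide by (simp only: times_divide_eq_right mult_ac)
    then have "D = 2 / 27 * (m\<^sub>0 * m) ^ 3 / ((M + 2 * L) ^ 3 * L\<^sup>2 * (1 + r\<^sub>0))"
      unfolding D_def by (simp add: power_divide)
    then show ?thesis
      unfolding assms(17) using c by simp
  qed

  have out: "a \<le> norm (grad f x)" if "x \<notin> cball xs \<delta>" for x
    unfolding a_def by (rule grad_norm_outside_ball[OF cvx C2 g0 \<delta> sc that])
  show ?thesis
    unfolding N0
  proof (rule drnm_reaches[where f = f and xs = xs, OF D min])
    fix x assume x: "f x \<le> f x0" "x \<notin> cball xs \<delta>"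
    let ?\<gamma> = "norm (grad f x)"
    have \<gamma>: "a \<le> ?\<gamma>" using out x(2) .
    then have g: "grad f x \<noteq> 0" using a by auto
    have xL: "x \<in> \<L>\<^sub>0" using x(1) assms(4) by simp
    have "?\<gamma> \<le> L * norm (x - xs)"
      using grad_norm_le[OF C2 g0 cvx0 xL xs_in] assms(6) by blast
    also have "\<dots> \<le> L * r\<^sub>0"
      using sub xL L by (auto simp: dist_norm norm_minus_commute)
    finally have \<gamma>r: "L + ?\<gamma> \<le> L * (1 + r\<^sub>0)" by (simp add: algebra_simps)
    \<comment> \<open>For the full step, \<open>a / (4 L) \<le> 1/2\<close> because \<open>a \<le> L\<close>; for the damped one, \<open>1/4 \<le> 3/8\<close>.\<close>
    have "a / (4 * L) \<le> min (1 / 2) (3 / 8 * ?\<gamma> / L)"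
      using aL \<gamma> a L by (simp add: field_simps)
    moreover have "a\<^sup>2 / (L * (1 + r\<^sub>0)) \<le> ?\<gamma>\<^sup>2 / (L + ?\<gamma>)"
      using \<gamma> a L \<gamma>r by (intro frac_le power_mono) (auto intro: add_pos_nonneg)
    ultimately have "a / (4 * L) * (a\<^sup>2 / (L * (1 + r\<^sub>0)))
        \<le> min (1 / 2) (3 / 8 * ?\<gamma> / L) * (?\<gamma>\<^sup>2 / (L + ?\<gamma>))"
      using a L r0 by (intro mult_mono) auto
    moreover have "D = a / (4 * L) * (a\<^sup>2 / (L * (1 + r\<^sub>0)))"
      unfolding D_def by (simp add: eval_nat_numeral)
    moreover have "f (drnm_step f L x) \<le> f x - min (1 / 2) (3 / 8 * ?\<gamma> / L) * (?\<gamma>\<^sup>2 / (L + ?\<gamma>))"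
      by (rule drnm_step_decrease[OF cvx C2 opL L g]) (use x(1) in simp)
    ultimately show "f (drnm_step f L x) \<le> f x - D" by linarith
    show "\<not> newton_decrement f x \<le> \<epsilon> powr 1.5"
    proof
      assume "newton_decrement f x \<le> \<epsilon> powr 1.5"
      then have "?\<gamma> < m\<^sub>0 * \<epsilon>"
        using stopping_test_grad_small[OF cvx C2 opL[OF x(1)] L \<open>0 < \<epsilon>\<close> m0] assms(16) xL by blast
      also have "\<dots> < a" unfolding a_def using m0 \<open>\<epsilon> < \<delta>\<close> by simp
      finally show False using \<gamma> by simp
    qed
  qed
qed

end
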